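(* Let $n\ge 1$. There is a bijection $\varphi:\mathcal{A}_n\to\mathcal{RS}_{n-1}$ such that $\mathrm{Last}(\sigma)-1=\mathrm{Last}(\varphi(\sigma))$ for all $\sigma\in\mathcal{A}_n$; in particular, for each $1\le k\le n$, $\varphi$ restricts to a bijection from $\mathcal{A}_{n,k}=\{\sigma\in\mathcal{A}_n:\sigma_n=k\}$ onto $\mathcal{RS}_{n-1,k-1}=\{\pi\in\mathcal{RS}_{n-1}:\pi_{n-1}=k-1\}$. Moreover, $\varphi$ can be chosen to preserve the $cd$-index, i.e. the reduced variation of $\sigma$ equals the reduced variation of the augmented Simsun permutation $0\,\varphi(\sigma)$.
   Context: For a permutation $\sigma=\sigma_1\cdots\sigma_n$ of $[n]=\{1,\dots,n\}$, $\mathrm{Last}(\sigma)=\sigma_n$, and $\sigma_{[k]}$ is the subword of $\sigma$ consisting of the letters $1,\dots,k$ in the order they appear. A double descent is a triple of consecutive letters $a>b>c$; a word ends with an ascent if its last two letters $x,y$ satisfy $x<y$. $\sigma$ is an André permutation if for every $1\le k\le n$, $\sigma_{[k]}$ has no double descents and ends with an ascent (vacuous for length 1); $\mathcal{A}_n$ is the set of André permutations of $[n]$. $\sigma$ is a Simsun permutation if for every $1\le k\le n$, $\sigma_{[k]}$ has no double descents; $\mathcal{RS}_n$ is the set of Simsun permutations of $[n]$. The variation of a word $w_1\cdots w_m$ is the word $u_1\cdots u_{m-1}$ in letters $\mathtt a,\mathtt b$ with $u_i=\mathtt a$ if $w_i<w_{i+1}$ and $u_i=\mathtt b$ if $w_i>w_{i+1}$.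 The reduced variation of an André permutation is obtained from its variation by replacing each $\mathtt{ba}$ by $\mathtt d$ and then each remaining $\mathtt a$ by $\mathtt c$. For a Simsun permutation $\pi$, the augmented permutation is $0\pi$ (prepend the letter $0$), and its reduced variation is obtained from the variation of $0\pi$ by replacing each $\mathtt{ab}$ by $\mathtt d$ and then each remaining $\mathtt a$ by $\mathtt c$. *)

theory Defs
  imports "HOL-Combinatorics.Multiset_Permutations"
begin

text \<open>
  Permutations of \<open>{1..n}\<close> are words in one-line notation, i.e. the elements of
  \<^term>\<open>permutations_of_set {1..n::nat}\<close>.
\<close>

definition subword_upto :: "nat \<Rightarrow> nat list \<Rightarrow> nat list" where
  "subword_upto k w = filter (\<lambda>x. x \<in> {1..k}) w"

definition has_double_descent :: "nat list \<Rightarrow> bool" where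
  "has_double_descent w \<longleftrightarrow>
     (\<exists>i. i + 2 < length w \<and> w ! i > w ! (i + 1) \<and> w ! (i + 1) > w ! (i + 2))"

text \<open>Vacuously true for words of length at most one.\<close>

definition ends_with_ascent :: "nat list \<Rightarrow> bool" where
  "ends_with_ascent w \<longleftrightarrow>
     (length w \<ge> 2 \<longrightarrow> w ! (length w - 2) < w ! (length w - 1))"

definition andre :: "nat \<Rightarrow> nat list set" where
  "andre n = {\<sigma> \<in> permutations_of_set {1..n}.
     \<forall>k\<in>{1..n}. \<not> has_double_descent (subword_upto k \<sigma>) \<and> ends_with_ascent (subword_upto k \<sigma>)}"

definition simsun :: "nat \<Rightarrow> nat list set" where
  "simsun n = {\<sigma> \<in> permutations_of_set {1..n}.
     \<forall>k\<in>{1..n}. \<not> has_double_descent (subword_upto k \<sigma>)}"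

text \<open>
  The empty permutation is the unique element of \<^term>\<open>simsun 0\<close>; its last letter is taken
  to be \<open>0\<close>, which is the last letter of the corresponding augmented permutation \<open>0\<pi>\<close>.
\<close>

definition Last :: "nat list \<Rightarrow> nat" where
  "Last w = (if w = [] then 0 else last w)"

definition andre_last :: "nat \<Rightarrow> nat \<Rightarrow> nat list set" where
  "andre_last n k = {\<sigma> \<in> andre n. Last \<sigma> = k}"

definition simsun_last :: "nat \<Rightarrow> nat \<Rightarrow> nat list set" where
  "simsun_last n k = {\<pi> \<in> simsun n. Last \<pi> = k}"

datatype letter = La | Lb | Lc | Ld

text \<open>Only applied to words with distinct letters, so \<^term>\<open>Lb\<close> marks exactly the descents.\<close>

definition variation :: "nat list \<Rightarrow> letter list" where
  "variation w = map (\<lambda>i. if w ! i < w ! (i + 1) then La else Lb) [0..<length w - 1]"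

text \<open>
  \<open>replace_pair x y z w\<close> replaces each factor \<open>xy\<close> of \<open>w\<close> by the letter \<open>z\<close>. It is used for
  \<open>x \<noteq> y\<close> only, when distinct occurrences of \<open>xy\<close> cannot overlap.
\<close>

fun replace_pair :: "letter \<Rightarrow> letter \<Rightarrow> letter \<Rightarrow> letter list \<Rightarrow> letter list" where
  "replace_pair x y z (u # v # w) =
     (if u = x \<and> v = y then z # replace_pair x y z w else u # replace_pair x y z (v # w))"
| "replace_pair x y z w = w"

definition a_to_c :: "letter list \<Rightarrow> letter list" where
  "a_to_c w = map (\<lambda>x. if x = La then Lc else x) w"

definition andre_reduced_variation :: "nat list \<Rightarrow> letter list" where
  "andre_reduced_variation \<sigma> = a_to_c (replace_pair Lb La Ld (variation \<sigma>))"

text \<open>To be applied to the augmented permutation \<open>0\<pi>\<close>, not to \<open>\<pi>\<close> itself.\<close>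

definition simsun_reduced_variation :: "nat list \<Rightarrow> letter list" where
  "simsun_reduced_variation w = a_to_c (replace_pair La Lb Ld (variation w))"

end

theory Submission imports Defs begin

text \<open>
  Both families grow by inserting a new largest letter. For an Andr\'e permutation the letter may be
  appended, or placed before any letter that starts an ascent; for an augmented Simsun permutation
  it may be appended, or placed before any letter other than the initial \<open>0\<close> that is last or starts
  an ascent. In either case the inner positions correspond to the letters of the reduced
  variation: inserting at a letter \<open>c\<close> turns it into \<open>d\<close>, inserting at a letter \<open>d\<close>
  turns it into \<open>cd\<close>, and neither changes the last letter of the permutation, while appending
  adds a final \<open>c\<close>. Hence both families are enumerated by the same sequences of insertion
  positions, and these sequences determine the reduced variation and the last letter up to
  a shift by one.
\<close>

section \<open>Insertion codes and the statistics they determine\<close>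

fun refine :: "letter list \<Rightarrow> nat \<Rightarrow> letter list" where
  "refine [] i = [Lc]"
| "refine (l # ls) 0 = (if l = Lc then Ld # ls else Lc # Ld # ls)"
| "refine (l # ls) (Suc i) = l # refine ls i"

text \<open>A code lists the insertion positions, the most recent one first.\<close>

fun code_word :: "nat list \<Rightarrow> letter list" where
  "code_word [] = []"
| "code_word (i # c) = refine (code_word c) i"

text \<open>The value is an offset from the starting letter: the letter appended after
  \<open>length c\<close> insertions lies \<open>Suc (length c)\<close> above it.\<close>

fun code_last :: "nat list \<Rightarrow> nat" where
  "code_last [] = 0"
| "code_last (i # c) = (if i < length (code_word c) then code_last c else Suc (length c))"

fun valid_code :: "nat list \<Rightarrow> bool" where
  "valid_code [] = True"
| "valid_code (i # c) = (valid_code c \<and> i \<le> length (code_word c))"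

definition codes :: "nat \<Rightarrow> nat list set" where
  "codes m = {c. length c = m \<and> valid_code c}"

lemma codes_0: "codes 0 = {[]}"
  by (auto simp: codes_def)

lemma codes_Suc: "c \<in> codes (Suc m) \<longleftrightarrow>
    (\<exists>i c'. c = i # c' \<and> c' \<in> codes m \<and> i \<le> length (code_word c'))"
  by (cases c) (auto simp: codes_def)

section \<open>Hereditary words grown by inserting the maximum\<close>

definition insertions :: "(nat list \<Rightarrow> bool) \<Rightarrow> nat \<Rightarrow> nat list \<Rightarrow> nat list set" where
  "insertions good N w = {u. \<exists>xs ys. w = xs @ ys \<and> u = xs @ N # ys \<and> good u}"

definition hereditary :: "(nat list \<Rightarrow> bool) \<Rightarrow> nat \<Rightarrow> nat \<Rightarrow> nat list set" where
  "hereditary good a n =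
     {w \<in> permutations_of_set {a..n}. \<forall>k\<in>{a..n}. good (filter (\<lambda>x. x \<le> k) w)}"

lemma hereditary_good: "w \<in> hereditary good a n \<Longrightarrow> a \<le> n \<Longrightarrow> good w"
proof -
  assume w: "w \<in> hereditary good a n" and "a \<le> n"
  then have "good (filter (\<lambda>x. x \<le> n) w)" by (auto simp: hereditary_def)
  moreover have "filter (\<lambda>x. x \<le> n) w = w"
    using w by (auto simp: hereditary_def permutations_of_set_def filter_id_conv)
  ultimately show ?thesis by simp
qed

text \<open>Restrictions of \<open>u\<close> to levels \<open>k \<le> n\<close> are restrictions of
  the filtered word, so level \<open>Suc n\<close> adds just one condition, goodness of
  \<open>u\<close> itself.\<close>

lemma hereditary_Suc:
  assumes "a \<le> n"
  shows "u \<in> hereditary good a (Suc n) \<longleftrightarrow>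
     filter (\<lambda>x. x \<le> n) u \<in> hereditary good a n \<and>
     u \<in> insertions good (Suc n) (filter (\<lambda>x. x \<le> n) u)"
    (is "?L \<longleftrightarrow> ?R")
proof
  assume L: ?L
  then have u: "set u = {a..Suc n}" "distinct u"
    by (auto simp: hereditary_def permutations_of_set_def)
  have "good u" using hereditary_good[OF L] assms by simp
  from u assms have "Suc n \<in> set u" by auto
  then obtain xs ys where xy: "u = xs @ Suc n # ys" by (meson split_list)
  then have "\<forall>x\<in>set (xs @ ys). x \<le> n"
    using u by (fastforce simp: set_eq_iff le_Suc_eq)
  then have "filter (\<lambda>x. x \<le> n) u = xs @ ys"
    using xy by (simp add: filter_id_conv)
  moreover have "filter (\<lambda>x. x \<le> k) (filter (\<lambda>x. x \<le> n) u) = filter (\<lambda>x. x \<le> k) u"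
    if "k \<le> n" for k
    using that by (auto intro: filter_cong)
  then have "filter (\<lambda>x. x \<le> n) u \<in> hereditary good a n"
    using L by (auto simp: hereditary_def permutations_of_set_def)
  ultimately show ?R
    using xy \<open>good u\<close> by (auto simp: insertions_def)
next
  assume R: ?R
  then obtain xs ys where xy: "filter (\<lambda>x. x \<le> n) u = xs @ ys" "u = xs @ Suc n # ys" "good u"
    by (auto simp: insertions_def)
  have set: "set (xs @ ys) = {a..n}" "distinct (xs @ ys)"
    and g: "\<forall>k\<in>{a..n}. good (filter (\<lambda>x. x \<le> k) (xs @ ys))"
    using R unfolding xy(1) by (auto simp: hereditary_def permutations_of_set_def)
  have "set u = insert (Suc n) (set (xs @ ys))" using xy(2) by auto
  then have 1: "set u = {a..Suc n}" using set assms by auto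
  have "Suc n \<notin> set (xs @ ys)" using set by simp
  then have 2: "distinct u" using set(2) xy(2) by auto
  have "good (filter (\<lambda>x. x \<le> k) u)" if "k \<in> {a..Suc n}" for k
  proof (cases "k = Suc n")
    case True
    then have "filter (\<lambda>x. x \<le> k) u = u" using 1 by (auto simp: filter_id_conv)
    then show ?thesis using xy(3) by simp
  next
    case False
    then show ?thesis using that g xy(2) by auto
  qed
  then show ?L using 1 2 by (auto simp: hereditary_def permutations_of_set_def)
qed

lemma hereditary_base: "good [a] \<Longrightarrow> hereditary good a a = {[a]}"
  by (auto simp: hereditary_def)

text \<open>The letters of \<open>word w\<close> index the inner positions, and
  \<open>length (word w)\<close> is the index that appends. Since \<open>word_ins\<close> and
  \<open>last_ins\<close> depend on \<open>w\<close> only through \<open>word w\<close> and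
  \<open>last w\<close>, instances driven by one code evolve in parallel.\<close>

locale insertion_scheme =
  fixes good :: "nat list \<Rightarrow> bool"
    and word :: "nat list \<Rightarrow> letter list"
    and ins :: "nat \<Rightarrow> nat list \<Rightarrow> nat \<Rightarrow> nat list"
  assumes good_single: "good [x]"
    and word_single: "word [x] = []"
    and ins_bij: "\<lbrakk>good w; distinct w; \<forall>x\<in>set w. x < N\<rbrakk> \<Longrightarrow>
          bij_betw (ins N w) {..length (word w)} (insertions good N w)"
    and word_ins: "\<lbrakk>good w; distinct w; \<forall>x\<in>set w. x < N\<rbrakk> \<Longrightarrow>
          word (ins N w i) = refine (word w) i"
    and last_ins: "\<lbrakk>good w; distinct w; \<forall>x\<in>set w. x < N\<rbrakk> \<Longrightarrow>
          last (ins N w i) = (if i < length (word w) then last w else N)"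
begin

fun build :: "nat \<Rightarrow> nat list \<Rightarrow> nat list" where
  "build a [] = [a]"
| "build a (i # c) = ins (Suc (a + length c)) (build a c) i"

text \<open>Deleting the maximum recovers the shorter word, hence by induction the shorter code;
  \<open>ins_bij\<close> then recovers the position. The statistics join the induction because valid
  positions are counted by \<open>code_word\<close>, but those of \<open>ins_bij\<close> by
  \<open>word\<close>.\<close>

lemma build_bij:
  "bij_betw (build a) (codes m) (hereditary good a (a + m)) \<and>
   (\<forall>c\<in>codes m. word (build a c) = code_word c \<and> last (build a c) = a + code_last c)"
proof (induction m)
  case 0
  then show ?case
    by (simp add: codes_0 hereditary_base good_single word_single bij_betw_def)
next
  case (Suc m)
  let ?N = "Suc (a + m)"
  have len: "length c = m" if "c \<in> codes m" for c using that by (simp add: codes_def)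
  have mem: "build a c \<in> hereditary good a (a + m)" if "c \<in> codes m" for c
    using Suc that by (auto simp: bij_betw_def)
  have g: "good (build a c)" "distinct (build a c)" "\<forall>x\<in>set (build a c). x < ?N"
    if "c \<in> codes m" for c
    using mem[OF that] hereditary_good[OF mem[OF that]]
    by (auto simp: hereditary_def permutations_of_set_def)
  have word: "word (build a c) = code_word c" and last: "last (build a c) = a + code_last c"
    if "c \<in> codes m" for c
    using Suc that by auto
  have bij: "bij_betw (ins ?N (build a c)) {..length (code_word c)} (insertions good ?N (build a c))"
    if "c \<in> codes m" for c
    using ins_bij[OF g[OF that]] word[OF that] by simp
  have rest: "filter (\<lambda>x. x \<le> a + m) u = build a c"
    if c: "c \<in> codes m" and u: "u \<in> insertions good ?N (build a c)" for u c
  proof -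
    from u obtain xs ys where "build a c = xs @ ys" "u = xs @ ?N # ys"
      by (auto simp: insertions_def)
    then show ?thesis using g(3)[OF c] by (auto simp: filter_id_conv less_Suc_eq_le)
  qed
  have insI: "ins ?N (build a c) i \<in> insertions good ?N (build a c)"
    if "c \<in> codes m" "i \<le> length (code_word c)" for c i
    using bij[OF that(1)] that(2) by (auto simp: bij_betw_def)
  have "inj_on (build a) (codes (Suc m))"
  proof (rule inj_onI)
    fix c d assume "c \<in> codes (Suc m)" "d \<in> codes (Suc m)" and eq: "build a c = build a d"
    then obtain i c' j d' where c: "c = i # c'" "c' \<in> codes m" "i \<le> length (code_word c')"
      and d: "d = j # d'" "d' \<in> codes m" "j \<le> length (code_word d')"
      unfolding codes_Suc by auto
    from eq have eq': "ins ?N (build a c') i = ins ?N (build a d') j"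
      using c d len by simp
    then have "build a c' = build a d'"
      using rest[OF c(2) insI[OF c(2,3)]] rest[OF d(2) insI[OF d(2,3)]] by simp
    then have "c' = d'" using Suc c(2) d(2) by (auto simp: bij_betw_def inj_on_def)
    with eq' bij[OF c(2)] c d show "c = d" by (auto simp: bij_betw_def inj_on_def)
  qed
  moreover have "build a ` codes (Suc m) = hereditary good a (a + Suc m)"
  proof (intro equalityI subsetI)
    fix u assume "u \<in> build a ` codes (Suc m)"
    then obtain i c where c: "u = ins ?N (build a c) i" "c \<in> codes m" "i \<le> length (code_word c)"
      by (auto simp: codes_Suc len)
    with insI rest mem show "u \<in> hereditary good a (a + Suc m)"
      by (auto simp: hereditary_Suc)
  next
    fix u assume "u \<in> hereditary good a (a + Suc m)"
    then have u: "filter (\<lambda>x. x \<le> a + m) u \<in> hereditary good a (a + m)"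
      "u \<in> insertions good ?N (filter (\<lambda>x. x \<le> a + m) u)"
      by (simp_all add: hereditary_Suc)
    then obtain c where c: "c \<in> codes m" "filter (\<lambda>x. x \<le> a + m) u = build a c"
      using Suc by (auto simp: bij_betw_def)
    with u(2) bij[OF c(1)] obtain i where "i \<le> length (code_word c)" "u = ins ?N (build a c) i"
      by (auto simp: bij_betw_def)
    then have "i # c \<in> codes (Suc m)" "u = build a (i # c)" using c len by (auto simp: codes_Suc)
    then show "u \<in> build a ` codes (Suc m)" by blast
  qed
  moreover have "word (build a c) = code_word c \<and> last (build a c) = a + code_last c"
    if "c \<in> codes (Suc m)" for c
    using that word_ins[OF g] last_ins[OF g] word last len by (auto simp: codes_Suc)
  ultimately show ?case by (simp add: bij_betw_def)
qed

end

section \<open>Recursion rules for words and for sets of insertions\<close>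

lemma has_double_descent_simps [simp]:
  "\<not> has_double_descent []"
  "\<not> has_double_descent [x]"
  "\<not> has_double_descent [x, y]"
  "has_double_descent (x # y # z # zs) \<longleftrightarrow> x > y \<and> y > z \<or> has_double_descent (y # z # zs)"
proof -
  have ex_nat: "(\<exists>i. P i) \<longleftrightarrow> P 0 \<or> (\<exists>i. P (Suc i))" for P :: "nat \<Rightarrow> bool"
    by (metis not0_implies_Suc)
  show "has_double_descent (x # y # z # zs) \<longleftrightarrow> x > y \<and> y > z \<or> has_double_descent (y # z # zs)"
    unfolding has_double_descent_def by (subst ex_nat) simp
qed (auto simp: has_double_descent_def)

lemma ends_with_ascent_simps [simp]:
  "ends_with_ascent []"
  "ends_with_ascent [x]"
  "ends_with_ascent [x, y] \<longleftrightarrow> x < y"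
  "ends_with_ascent (x # y # z # zs) \<longleftrightarrow> ends_with_ascent (y # z # zs)"
  by (auto simp: ends_with_ascent_def)

lemma variation_simps [simp]:
  "variation [] = []"
  "variation [x] = []"
  "variation (x # y # zs) = (if x < y then La else Lb) # variation (y # zs)"
proof -
  have upt: "[0..<length (x # y # zs) - 1] = 0 # map Suc [0..<length zs]"
    by (simp only: map_Suc_upt upt_conv_Cons list.size diff_Suc_1 zero_less_Suc add_Suc_right add_0_right)
  show "variation (x # y # zs) = (if x < y then La else Lb) # variation (y # zs)"
    unfolding variation_def upt by (simp del: upt_Suc add: comp_def)
qed (simp_all add: variation_def)

lemma replace_pair_skip: "u \<noteq> x \<Longrightarrow> replace_pair x y z (u # w) = u # replace_pair x y z w"
  by (cases w) auto

lemma insertions_Nil: "insertions good N [] = (if good [N] then {[N]} else {})"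
  by (auto simp: insertions_def)

text \<open>The new letter stands in front of \<open>x\<close> or behind it; in the second case the
  prefix \<open>x\<close> moves into the predicate, which is why \<open>insertions\<close> takes an
  arbitrary one.\<close>

lemma insertions_Cons:
  "insertions good N (x # w) =
     (if good (N # x # w) then {N # x # w} else {}) \<union> (#) x ` insertions (\<lambda>v. good (x # v)) N w"
    (is "?L = ?R")
proof (intro equalityI subsetI)
  fix u assume "u \<in> ?L"
  then obtain xs ys where "x # w = xs @ ys" "u = xs @ N # ys" "good u"
    by (auto simp: insertions_def)
  then show "u \<in> ?R"
    by (cases xs) (auto simp: insertions_def)
next
  fix u assume "u \<in> ?R"
  then consider "u = N # x # w" "good u"
    | xs ys where "w = xs @ ys" "u = x # xs @ N # ys" "good u"
    by (auto simp: insertions_def split: if_splits)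
  then show "u \<in> ?L"
  proof cases
    case 1
    then show ?thesis
      unfolding insertions_def mem_Collect_eq by (intro exI[of _ "[]"] exI[of _ "x # w"]) simp
  next
    case 2
    then show ?thesis
      unfolding insertions_def mem_Collect_eq by (intro exI[of _ "x # xs"] exI[of _ ys]) simp
  qed
qed

text \<open>Every insertion into \<open>w\<close> is headed by \<open>N\<close> or by the head of
  \<open>w\<close>. This serves to strip the prefixes that \<open>insertions_Cons\<close> puts into
  the predicate.\<close>

lemma insertions_cong:
  assumes "\<And>v. v \<noteq> [] \<Longrightarrow> hd v = N \<or> w \<noteq> [] \<and> hd v = hd w \<Longrightarrow> good v = good' v"
  shows "insertions good N w = insertions good' N w"
proof -
  have "good (xs @ N # ys) = good' (xs @ N # ys)" if "w = xs @ ys" for xs ys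
    using that by (intro assms) (cases xs; simp)+
  then show ?thesis by (auto simp: insertions_def)
qed

text \<open>Index step for inductions over blocks: 0 is the insertion \<open>u\<close> at the first
  block, \<open>Suc j\<close> is insertion \<open>j\<close> into the remainder, with the prefix
  restored by \<open>h\<close>.\<close>

lemma bij_betw_case_nat:
  assumes f: "bij_betw f {..L} I" and "inj h" and "u \<notin> h ` I"
  shows "bij_betw (\<lambda>i. case i of 0 \<Rightarrow> u | Suc j \<Rightarrow> h (f j)) {..Suc L} (insert u (h ` I))"
proof -
  have "inj_on (\<lambda>i. case i of 0 \<Rightarrow> u | Suc j \<Rightarrow> h (f j)) {..Suc L}"
    using assms by (auto simp: inj_on_def bij_betw_def split: nat.splits dest: injD)
  moreover have "(\<lambda>i. case i of 0 \<Rightarrow> u | Suc j \<Rightarrow> h (f j)) ` {..Suc L} = insert u (h ` f ` {..L})"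
    by (simp only: atMost_Suc_eq_insert_0 image_insert image_image) simp
  ultimately show ?thesis using f by (simp add: bij_betw_def)
qed

section \<open>Andr\'e permutations\<close>

text \<open>Parses a word into the blocks of its reduced variation: an ascent gives
  \<open>Lc\<close>, a descent with the ascent after it gives \<open>Ld\<close>.\<close>

inductive andre_good :: "nat list \<Rightarrow> bool" where
  single: "andre_good [x]"
| ascent: "x < y \<Longrightarrow> andre_good (y # w) \<Longrightarrow> andre_good (x # y # w)"
| valley: "y < x \<Longrightarrow> y < z \<Longrightarrow> andre_good (z # w) \<Longrightarrow> andre_good (x # y # z # w)"

lemma andre_good_simps [simp]:
  "\<not> andre_good []"
  "andre_good [x]"
  "x < y \<Longrightarrow> andre_good (x # y # w) \<longleftrightarrow> andre_good (y # w)"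
  "y < x \<Longrightarrow> andre_good (x # y # w) \<longleftrightarrow> w \<noteq> [] \<and> y < hd w \<and> andre_good w"
  by (auto elim: andre_good.cases intro: andre_good.intros simp: neq_Nil_conv)

text \<open>Index 0 acts on the first block. At an ascent the new letter goes before
  \<open>x\<close>; at a valley it goes before \<open>y\<close>, since before \<open>x\<close> it
  would start a double descent.\<close>

fun andre_ins :: "nat \<Rightarrow> nat list \<Rightarrow> nat \<Rightarrow> nat list" where
  "andre_ins N [] i = []"
| "andre_ins N [x] i = [x, N]"
| "andre_ins N (x # y # w) i =
     (if x < y then (case i of 0 \<Rightarrow> N # x # y # w | Suc j \<Rightarrow> x # andre_ins N (y # w) j)
      else (case i of 0 \<Rightarrow> x # N # y # w | Suc j \<Rightarrow> x # y # andre_ins N w j))"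

lemma andre_reduced_variation_simps [simp]:
  "andre_reduced_variation [x] = []"
  "x < y \<Longrightarrow> andre_reduced_variation (x # y # w) = Lc # andre_reduced_variation (y # w)"
  "y < x \<Longrightarrow> y < z \<Longrightarrow>
     andre_reduced_variation (x # y # z # w) = Ld # andre_reduced_variation (z # w)"
  by (simp_all add: andre_reduced_variation_def a_to_c_def replace_pair_skip)

lemma andre_ins_bij:
  "\<lbrakk>andre_good w; \<forall>x\<in>set w. x < N\<rbrakk> \<Longrightarrow>
   bij_betw (andre_ins N w) {..length (andre_reduced_variation w)} (insertions andre_good N w)"
proof (induction rule: andre_good.induct)
  case (single x)
  then show ?case by (simp add: insertions_Cons insertions_Nil bij_betw_def)
next
  case (ascent x y w)
  \<comment> \<open>Both possible heads, \<open>y\<close> and \<open>N\<close>, exceed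
    \<open>x\<close>, so the prefix does not affect goodness.\<close>
  have "insertions (\<lambda>v. andre_good (x # v)) N (y # w) = insertions andre_good N (y # w)"
    using ascent by (intro insertions_cong) (auto simp: neq_Nil_conv)
  then have "insertions andre_good N (x # y # w) =
      insert (N # x # y # w) ((#) x ` insertions andre_good N (y # w))"
    using ascent by (subst insertions_Cons) auto
  with bij_betw_case_nat[of _ _ _ "(#) x" "N # x # y # w"] ascent show ?case
    by auto
next
  case (valley y x z w)
  \<comment> \<open>Likewise both possible heads, \<open>z\<close> and \<open>N\<close>, exceed the
    valley bottom \<open>y\<close>.\<close>
  have "insertions (\<lambda>v. andre_good (x # y # v)) N (z # w) = insertions andre_good N (z # w)"
    using valley by (intro insertions_cong) (auto simp: neq_Nil_conv)
  then have "insertions andre_good N (x # y # z # w) =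
      insert (x # N # y # z # w) ((\<lambda>v. x # y # v) ` insertions andre_good N (z # w))"
    using valley by (subst insertions_Cons, subst insertions_Cons) auto
  with bij_betw_case_nat[of _ _ _ "\<lambda>v. x # y # v" "x # N # y # z # w"] valley show ?case
    by (auto simp: inj_def)
qed

text \<open>Needed at block boundaries: a letter below both \<open>hd w\<close> and \<open>N\<close>
  stays below the new head, so the preceding block is unchanged.\<close>

lemma andre_ins_hd: "w \<noteq> [] \<Longrightarrow> andre_ins N w i \<noteq> [] \<and> hd (andre_ins N w i) \<in> {hd w, N}"
  by (cases "(N, w, i)" rule: andre_ins.cases) (auto split: nat.splits)

lemma andre_reduced_variation_ins:
  "\<lbrakk>andre_good w; \<forall>x\<in>set w. x < N\<rbrakk> \<Longrightarrow>
   andre_reduced_variation (andre_ins N w i) = refine (andre_reduced_variation w) i"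
proof (induction arbitrary: i rule: andre_good.induct)
  case (single x)
  then show ?case by simp
next
  case (ascent x y w)
  show ?case
  proof (cases i)
    case (Suc j)
    then show ?thesis using ascent ascent.IH[of j] andre_ins_hd[of "y # w" N j]
      by (cases "andre_ins N (y # w) j") auto
  qed (use ascent in auto)
next
  case (valley y x z w)
  show ?case
  proof (cases i)
    case (Suc j)
    then show ?thesis using valley valley.IH[of j] andre_ins_hd[of "z # w" N j]
      by (cases "andre_ins N (z # w) j") auto
  qed (use valley in auto)
qed

lemma last_andre_ins:
  "andre_good w \<Longrightarrow>
   last (andre_ins N w i) = (if i < length (andre_reduced_variation w) then last w else N)"
proof (induction arbitrary: i rule: andre_good.induct)
  case (ascent x y w)
  then show ?case using andre_ins_hd[of "y # w" N] by (cases i) auto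
next
  case (valley y x z w)
  then show ?case using andre_ins_hd[of "z # w" N] by (cases i) auto
qed auto

interpretation andre: insertion_scheme andre_good andre_reduced_variation andre_ins
  by unfold_locales (simp_all add: andre_ins_bij andre_reduced_variation_ins last_andre_ins)

text \<open>A descent can be neither last nor followed by a descent, so it opens a valley. Valleys
  consume two letters, hence the induction on length.\<close>

lemma andre_good_iff:
  "distinct (x # w) \<Longrightarrow>
   andre_good (x # w) \<longleftrightarrow> \<not> has_double_descent (x # w) \<and> ends_with_ascent (x # w)"
proof (induction "length w" arbitrary: x w rule: less_induct)
  case less
  show ?case
  proof (cases w)
    case w: (Cons y v)
    show ?thesis
    proof (cases v)
      case Nil
      then show ?thesis using w less(2) by (cases "x < y") auto
    next
      case (Cons z u)
      then show ?thesis using w less(2) less(1)[of "z # u" y] less(1)[of u z]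
        by (cases "x < y"; cases "y < z"; cases u) (auto simp: not_less)
    qed
  qed auto
qed

lemma andre_eq_hereditary:
  assumes "n \<ge> 1"
  shows "andre n = hereditary andre_good 1 n"
proof -
  have "andre_good (filter (\<lambda>x. x \<le> k) w) \<longleftrightarrow>
      \<not> has_double_descent (subword_upto k w) \<and> ends_with_ascent (subword_upto k w)"
    if "w \<in> permutations_of_set {1..n}" "k \<in> {1..n}" for w k
  proof -
    have eq: "subword_upto k w = filter (\<lambda>x. x \<le> k) w"
      using that by (auto simp: subword_upto_def permutations_of_set_def intro!: filter_cong)
    \<comment> \<open>The letter 1 survives every restriction. Nonemptiness matters: the empty word
      satisfies the conditions vacuously, but \<open>andre_good\<close> rejects it.\<close>
    have "1 \<in> set (filter (\<lambda>x. x \<le> k) w)" using that by (auto simp: permutations_of_set_def)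
    then obtain x v where "filter (\<lambda>x. x \<le> k) w = x # v"
      by (metis list.set_cases)
    moreover have "distinct (filter (\<lambda>x. x \<le> k) w)"
      using that by (simp add: permutations_of_set_def)
    ultimately show ?thesis using andre_good_iff eq by metis
  qed
  then show ?thesis by (auto simp: andre_def hereditary_def)
qed

section \<open>Simsun permutations\<close>

text \<open>Blocks again mirror the reduced variation: \<open>Lc\<close> for a plain ascent,
  \<open>Ld\<close> for a peak. Goodness of \<open>z # w\<close> forces an ascent after
  \<open>z\<close> if anything follows, which excludes double descents.\<close>

inductive simsun_good :: "nat list \<Rightarrow> bool" where
  single: "simsun_good [x]"
| ascent: "x < y \<Longrightarrow> simsun_good (y # w) \<Longrightarrow> simsun_good (x # y # w)"
| peak: "x < y \<Longrightarrow> z < y \<Longrightarrow> simsun_good (z # w) \<Longrightarrow> simsun_good (x # y # z # w)"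

lemma simsun_good_hd: "simsun_good (y # w) \<Longrightarrow> w \<noteq> [] \<Longrightarrow> y < hd w"
  by (auto elim: simsun_good.cases)

lemma simsun_good_simps [simp]:
  "simsun_good [x]"
  "\<not> x < y \<Longrightarrow> \<not> simsun_good (x # y # w)"
  "simsun_good [x, y] \<longleftrightarrow> x < y"
  "y < z \<Longrightarrow> simsun_good (x # y # z # w) \<longleftrightarrow> x < y \<and> simsun_good (y # z # w)"
  "z < y \<Longrightarrow> simsun_good (x # y # z # w) \<longleftrightarrow> x < y \<and> simsun_good (z # w)"
  using simsun_good_hd[of y "z # w"]
  by (auto elim: simsun_good.cases intro: simsun_good.intros)

text \<open>The first letter is never displaced, as \<open>N\<close> in front of it would create an
  initial descent. At a plain ascent \<open>N\<close> goes before \<open>y\<close>; at a peak it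
  goes after \<open>y\<close>, because before \<open>y\<close> it would start a double
  descent.\<close>

fun simsun_ins :: "nat \<Rightarrow> nat list \<Rightarrow> nat \<Rightarrow> nat list" where
  "simsun_ins N [] i = []"
| "simsun_ins N [x] i = [x, N]"
| "simsun_ins N (x # y # w) i =
     (if w = [] \<or> y < hd w
      then (case i of 0 \<Rightarrow> x # N # y # w | Suc j \<Rightarrow> x # simsun_ins N (y # w) j)
      else (case i of 0 \<Rightarrow> x # y # N # w | Suc j \<Rightarrow> x # y # simsun_ins N w j))"

lemma simsun_reduced_variation_simps [simp]:
  "simsun_reduced_variation [x] = []"
  "x < y \<Longrightarrow> w = [] \<or> y < hd w \<Longrightarrow>
     simsun_reduced_variation (x # y # w) = Lc # simsun_reduced_variation (y # w)"
  "x < y \<Longrightarrow> z < y \<Longrightarrow>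
     simsun_reduced_variation (x # y # z # w) = Ld # simsun_reduced_variation (z # w)"
  by (cases w; auto simp: simsun_reduced_variation_def a_to_c_def replace_pair_skip)+

lemma simsun_ins_bij:
  "\<lbrakk>simsun_good w; \<forall>x\<in>set w. x < N\<rbrakk> \<Longrightarrow>
   bij_betw (simsun_ins N w) {..length (simsun_reduced_variation w)} (insertions simsun_good N w)"
proof (induction rule: simsun_good.induct)
  case (single x)
  then show ?case by (simp add: insertions_Cons insertions_Nil bij_betw_def)
next
  case (ascent x y w)
  have hd: "w = [] \<or> y < hd w" using ascent simsun_good_hd by auto
  \<comment> \<open>The head of \<open>v\<close> is \<open>N\<close> or that of \<open>w\<close>, in
    either case above \<open>y\<close>, so \<open>x < y\<close> merely adds an ascent block.\<close>
  have "insertions (\<lambda>v. simsun_good (x # y # v)) N w = insertions (\<lambda>v. simsun_good (y # v)) N w"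
    using ascent hd by (intro insertions_cong) (auto simp: neq_Nil_conv)
  then have "insertions simsun_good N (x # y # w) =
      insert (x # N # y # w) ((#) x ` insertions simsun_good N (y # w))"
    using ascent by (simp add: insertions_Cons)
  with bij_betw_case_nat[of _ _ _ "(#) x" "x # N # y # w"] ascent hd show ?case
    by (auto simp: insertions_Cons)
next
  case (peak x y z w)
  have "insertions (\<lambda>v. simsun_good (x # y # z # v)) N w = insertions (\<lambda>v. simsun_good (z # v)) N w"
    using peak by simp
  then have "insertions simsun_good N (x # y # z # w) =
      insert (x # y # N # z # w) ((\<lambda>v. x # y # v) ` insertions simsun_good N (z # w))"
    using peak by (simp add: insertions_Cons image_image)
  with bij_betw_case_nat[of _ _ _ "\<lambda>v. x # y # v" "x # y # N # z # w"] peak show ?case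
    by (auto simp: insertions_Cons inj_def)
qed

text \<open>The second letter must be controlled too: it decides whether the head starts an ascent,
  and thereby whether the block before it is \<open>Lc\<close> or \<open>Ld\<close>.\<close>

lemma simsun_ins_Cons:
  "\<exists>v. simsun_ins N (x # w) i = x # v \<and> v \<noteq> [] \<and> (hd v = N \<or> w \<noteq> [] \<and> hd v = hd w)"
proof -
  have head: "\<exists>v. simsun_ins N (y # u) j = y # v" for y u j
    by (cases u; cases j) auto
  show ?thesis
  proof (cases w)
    case (Cons y u)
    then show ?thesis using head[of y u "i - 1"] by (cases i) auto
  qed auto
qed

lemma simsun_reduced_variation_ins:
  "\<lbrakk>simsun_good w; \<forall>x\<in>set w. x < N\<rbrakk> \<Longrightarrow>
   simsun_reduced_variation (simsun_ins N w i) = refine (simsun_reduced_variation w) i"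
proof (induction arbitrary: i rule: simsun_good.induct)
  case (single x)
  then show ?case by simp
next
  case (ascent x y w)
  have hd: "w = [] \<or> y < hd w" using ascent simsun_good_hd by auto
  show ?case
  proof (cases i)
    case (Suc j)
    obtain v where "simsun_ins N (y # w) j = y # v" "hd v = N \<or> w \<noteq> [] \<and> hd v = hd w"
      using simsun_ins_Cons by blast
    then show ?thesis using Suc ascent hd ascent.IH[of j] by auto
  qed (use ascent hd in auto)
next
  case (peak x y z w)
  show ?case
  proof (cases i)
    case (Suc j)
    obtain v where "simsun_ins N (z # w) j = z # v" using simsun_ins_Cons by blast
    then show ?thesis using Suc peak peak.IH[of j] by auto
  qed (use peak in auto)
qed

lemma last_simsun_ins:
  "simsun_good w \<Longrightarrow>
   last (simsun_ins N w i) = (if i < length (simsun_reduced_variation w) then last w else N)"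
proof (induction arbitrary: i rule: simsun_good.induct)
  case (ascent x y w)
  have "w = [] \<or> y < hd w" using ascent simsun_good_hd by auto
  with ascent show ?case using simsun_ins_Cons[of N y w "i - 1"] by (cases i) auto
next
  case (peak x y z w)
  then show ?case using simsun_ins_Cons[of N z w "i - 1"] by (cases i) auto
qed auto

interpretation simsun: insertion_scheme simsun_good simsun_reduced_variation simsun_ins
  by unfold_locales (simp_all add: simsun_ins_bij simsun_reduced_variation_ins last_simsun_ins)

text \<open>The initial ascent belongs to the invariant because it recurs: the letter after a peak,
  if not last, must start an ascent.\<close>

lemma simsun_good_iff:
  "distinct (x # w) \<Longrightarrow>
   simsun_good (x # w) \<longleftrightarrow> \<not> has_double_descent (x # w) \<and> (w \<noteq> [] \<longrightarrow> x < hd w)"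
proof (induction "length w" arbitrary: x w rule: less_induct)
  case less
  show ?case
  proof (cases w)
    case w: (Cons y v)
    show ?thesis
    proof (cases v)
      case Nil
      then show ?thesis using w less(2) by auto
    next
      case (Cons z u)
      then show ?thesis using w less(2) less(1)[of "z # u" y] less(1)[of u z]
        by (cases "y < z"; cases u) auto
    qed
  qed auto
qed

lemma simsun_eq_hereditary: "(#) 0 ` simsun n = hereditary simsun_good 0 n"
proof -
  \<comment> \<open>Goodness at all levels puts 0 first: restricted to the level of its first letter
    \<open>h\<close>, the word begins with its maximum. If \<open>h\<close> is not 0, then 0 comes
    later, so there is an initial descent.\<close>
  have hd0: "\<exists>v. w = 0 # v"
    if w: "w \<in> permutations_of_set {0..n}" and good: "\<forall>k\<in>{0..n}. simsun_good (filter (\<lambda>x. x \<le> k) w)" for w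
  proof (rule ccontr)
    assume no: "\<nexists>v. w = 0 # v"
    have set: "set w = {0..n}" using w by (simp add: permutations_of_set_def)
    then obtain h v where hv: "w = h # v" by (cases w) auto
    with no set have h: "0 \<in> set v" "h \<in> {0..n}" by auto
    then have ne: "filter (\<lambda>x. x \<le> h) v \<noteq> []" by (auto simp: filter_empty_conv)
    have "simsun_good (h # filter (\<lambda>x. x \<le> h) v)" using good h hv by force
    then have "h < hd (filter (\<lambda>x. x \<le> h) v)" using ne by (rule simsun_good_hd)
    moreover have "hd (filter (\<lambda>x. x \<le> h) v) \<in> set (filter (\<lambda>x. x \<le> h) v)"
      using ne by (rule hd_in_set)
    ultimately show False by simp
  qed
  have perm: "0 # v \<in> permutations_of_set {0..n} \<longleftrightarrow> v \<in> permutations_of_set {1..n}" for v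
  proof -
    have "{0..n} = insert 0 {1..n}" by auto
    then show ?thesis by (auto simp: permutations_of_set_def insert_ident)
  qed
  \<comment> \<open>Prepending 0 creates no double descent and supplies the initial ascent.\<close>
  have good: "simsun_good (filter (\<lambda>x. x \<le> k) (0 # v)) \<longleftrightarrow> \<not> has_double_descent (subword_upto k v)"
    if v: "v \<in> permutations_of_set {1..n}" for k v
  proof -
    have eq: "subword_upto k v = filter (\<lambda>x. x \<le> k) v"
      using v by (auto simp: subword_upto_def permutations_of_set_def intro!: filter_cong)
    have pos: "0 \<notin> set (filter (\<lambda>x. x \<le> k) v)" and dist: "distinct (filter (\<lambda>x. x \<le> k) v)"
      using v by (auto simp: permutations_of_set_def)
    define u where "u = filter (\<lambda>x. x \<le> k) v"
    have "has_double_descent (0 # u) = has_double_descent u"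
      by (cases u rule: remdups_adj.cases) auto
    moreover have "u \<noteq> [] \<Longrightarrow> 0 < hd u" using pos hd_in_set[of u] by (metis gr0I u_def)
    ultimately show ?thesis using pos dist simsun_good_iff[of 0 u] eq by (simp add: u_def)
  qed
  \<comment> \<open>Augmentation adds level 0, where the subword is empty.\<close>
  have zero: "\<not> has_double_descent (subword_upto 0 v)" for v
    by (simp add: subword_upto_def)
  show ?thesis
  proof (intro equalityI subsetI)
    fix w assume "w \<in> (#) 0 ` simsun n"
    then obtain v where v: "w = 0 # v" "v \<in> permutations_of_set {1..n}"
      "\<forall>k\<in>{1..n}. \<not> has_double_descent (subword_upto k v)"
      by (auto simp: simsun_def)
    then have "\<not> has_double_descent (subword_upto k v)" if "k \<le> n" for k
      using zero that by (cases "k = 0") auto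
    then show "w \<in> hereditary simsun_good 0 n"
      using v perm good by (auto simp del: filter.simps simp: hereditary_def)
  next
    fix w assume "w \<in> hereditary simsun_good 0 n"
    then have w: "w \<in> permutations_of_set {0..n}" "\<forall>k\<in>{0..n}. simsun_good (filter (\<lambda>x. x \<le> k) w)"
      by (auto simp: hereditary_def)
    then obtain v where "w = 0 # v" using hd0 by blast
    then show "w \<in> (#) 0 ` simsun n"
      using w perm good by (auto simp del: filter.simps simp: simsun_def)
  qed
qed

section \<open>Matching the two families through their common codes\<close>

theorem theorem2p7:
  fixes n :: nat
  assumes "n \<ge> 1"
  shows "\<exists>\<phi> :: nat list \<Rightarrow> nat list.
     bij_betw \<phi> (andre n) (simsun (n - 1)) \<and>
     (\<forall>\<sigma>\<in>andre n. int (Last \<sigma>) - 1 = int (Last (\<phi> \<sigma>))) \<and>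
     (\<forall>k\<in>{1..n}. bij_betw \<phi> (andre_last n k) (simsun_last (n - 1) (k - 1))) \<and>
     (\<forall>\<sigma>\<in>andre n. andre_reduced_variation \<sigma> = simsun_reduced_variation (0 # \<phi> \<sigma>))"
proof -
  define m where "m = n - 1"
  have n: "n = 1 + m" using assms by (simp add: m_def)
  \<comment> \<open>Decode, rebuild from the same code starting with 0 instead of 1, and strip the
    leading 0. Codes have length \<open>n - 1\<close> since the starting letter needs no
    insertion.\<close>
  define \<phi> where "\<phi> = tl \<circ> simsun.build 0 \<circ> inv_into (codes m) (andre.build 1)"
  have A: "bij_betw (andre.build 1) (codes m) (andre n)"
    using andre.build_bij[of 1 m] assms by (simp add: andre_eq_hereditary n)
  have S: "bij_betw (simsun.build 0) (codes m) ((#) 0 ` simsun m)"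
    using simsun.build_bij[of 0 m] by (simp add: simsun_eq_hereditary)
  have "bij_betw tl ((#) 0 ` simsun m) (simsun m)"
    by (rule bij_betwI[where g = "(#) 0"]) auto
  then have bij: "bij_betw \<phi> (andre n) (simsun m)"
    unfolding \<phi>_def
    by (intro bij_betw_trans[OF bij_betw_inv_into[OF A]] bij_betw_trans[OF S])
  have "Last \<sigma> = Suc (Last (\<phi> \<sigma>)) \<and>
      andre_reduced_variation \<sigma> = simsun_reduced_variation (0 # \<phi> \<sigma>)"
    if "\<sigma> \<in> andre n" for \<sigma>
  proof -
    have "\<sigma> \<in> andre.build 1 ` codes m"
      using bij_betw_imp_surj_on[OF A] that by simp
    then obtain c where c: "c \<in> codes m" "\<sigma> = andre.build 1 c"
      by (elim imageE)
    have "inv_into (codes m) (andre.build 1) \<sigma> = c"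
      unfolding c(2) using bij_betw_imp_inj_on[OF A] c(1) by (rule inv_into_f_f)
    then have tl: "\<phi> \<sigma> = tl (simsun.build 0 c)" by (simp add: \<phi>_def)
    have "simsun.build 0 c \<in> (#) 0 ` simsun m" 
      using bij_betw_imp_surj_on[OF S] imageI[OF c(1), of "simsun.build 0"] by simp
    then obtain \<pi> where "simsun.build 0 c = 0 # \<pi>" by blast
    with tl have *: "0 # \<phi> \<sigma> = simsun.build 0 c" by simp
    \<comment> \<open>The default \<open>Last [] = 0\<close> covers the empty permutation.\<close>
    have "Last (\<phi> \<sigma>) = last (0 # \<phi> \<sigma>)" by (simp add: Last_def)
    then have "Last (\<phi> \<sigma>) = last (simsun.build 0 c)" unfolding * .
    moreover have "\<sigma> \<noteq> []"
      using that assms by (auto simp: andre_def permutations_of_set_def)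
    \<comment> \<open>The starting letters 1 and 0 of the two builds account for the shift of the
      last letter.\<close>
    ultimately show ?thesis
      using conjunct2[OF andre.build_bij[of 1 m]] conjunct2[OF simsun.build_bij[of 0 m]] c *
      by (simp add: Last_def)
  qed
  note stat = this
  have "bij_betw \<phi> (andre_last n k) (simsun_last m (k - 1))" if "k \<in> {1..n}" for k
  proof -
    have "\<phi> ` andre_last n k = simsun_last m (k - 1)"
    proof (intro equalityI subsetI)
      fix \<pi> assume "\<pi> \<in> simsun_last m (k - 1)"
      then have \<pi>: "\<pi> \<in> \<phi> ` andre n" "Last \<pi> = k - 1"
        using bij_betw_imp_surj_on[OF bij] by (simp_all add: simsun_last_def)
      then obtain \<sigma> where "\<sigma> \<in> andre n" "\<pi> = \<phi> \<sigma>"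
        by (elim imageE)
      \<comment> \<open>\<open>Last \<sigma>\<close> is the successor of \<open>k - 1\<close>, which
        is \<open>k\<close> because \<open>k \<ge> 1\<close>.\<close>
      with \<pi>(2) have "\<sigma> \<in> andre_last n k" "\<pi> = \<phi> \<sigma>"
        using stat that by (auto simp: andre_last_def)
      then show "\<pi> \<in> \<phi> ` andre_last n k" by (rule rev_image_eqI)
    next
      fix \<pi> assume "\<pi> \<in> \<phi> ` andre_last n k"
      then obtain \<sigma> where "\<sigma> \<in> andre n" "Last \<sigma> = k" "\<pi> = \<phi> \<sigma>"
        by (auto simp: andre_last_def)
      then show "\<pi> \<in> simsun_last m (k - 1)"
        using stat bij_betwE[OF bij] by (auto simp: simsun_last_def)
    qed
    moreover have "inj_on \<phi> (andre_last n k)"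
      using bij_betw_imp_inj_on[OF bij] by (rule inj_on_subset) (auto simp: andre_last_def)
    ultimately show ?thesis by (simp add: bij_betw_def)
  qed
  with bij stat show ?thesis
    unfolding m_def[symmetric] by (intro exI[of _ \<phi>] conjI ballI) simp_all
qed

end
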